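(* Let $\ell,m$ be integers with $0\le\ell\le m$. There exists a positive constant $C=C(\ell,m)$, depending only on $\ell$ and $m$ (and not on $L$ or on the curve), such that for every $L>0$ and every smooth arc-length parametrized closed plane curve $\boldsymbol f:\mathbb R/L\mathbb Z\to\mathbb R^2$ with rotation number $1$, $$I_\ell\le C\left(I_{-1}^{\frac{m-\ell}{2}}I_m+I_{-1}^{\frac{m-\ell}{m+1}}I_m^{\frac{\ell+1}{m+1}}\right).$$
   Context: For an arc-length parametrized closed curve $\boldsymbol f=(f_1,f_2):\mathbb R/L\mathbb Z\to\mathbb R^2$ (so $\|\boldsymbol f'\|\equiv1$), let $\boldsymbol\nu=(-f_2',f_1')$, $\boldsymbol\kappa=\boldsymbol f''$, and let $\kappa=\boldsymbol\kappa\cdot\boldsymbol\nu$ be the curvature. The curve need not be simple or convex. Rotation number $1$ means $\int_0^L\kappa\,ds=2\pi$. The signed area is $A=-\frac12\int_0^L\boldsymbol f\cdot\boldsymbol\nu\,ds$. The deviation of curvature is $\tilde\kappa=\kappa-\frac1L\int_0^L\kappa\,ds=\kappa-\frac{2\pi}{L}$. Set $$I_{-1}=1-\frac{4\pi A}{L^2},\qquad I_\ell=L^{2\ell+1}\int_0^L|\tilde\kappa^{(\ell)}|^2\,ds\quad(\ell=0,1,2,\dots),$$ where $\tilde\kappa^{(\ell)}$ is the $\ell$-th derivative in arc-length. By the isoperimetric inequality, $I_{-1}\ge0$. Zeroth powers are read as $1$. *)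

theory Defs
  imports "HOL-Analysis.Analysis"
begin

text \<open>A curve on the circle of length \<open>L\<close> is represented by an \<open>L\<close>-periodic function on the line.\<close>

definition nth_vderiv :: "nat \<Rightarrow> (real \<Rightarrow> 'a::real_normed_vector) \<Rightarrow> real \<Rightarrow> 'a" where
  "nth_vderiv n f = ((\<lambda>g t. vector_derivative g (at t)) ^^ n) f"

definition smooth :: "(real \<Rightarrow> 'a::real_normed_vector) \<Rightarrow> bool" where
  "smooth f \<longleftrightarrow> (\<forall>n t. nth_vderiv n f differentiable (at t))"

definition arclength_closed_curve :: "real \<Rightarrow> (real \<Rightarrow> real ^ 2) \<Rightarrow> bool" where
  "arclength_closed_curve L f \<longleftrightarrow>
     smooth f \<and> (\<forall>t. f (t + L) = f t) \<and> (\<forall>t. norm (nth_vderiv 1 f t) = 1)"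

definition normal_vec :: "(real \<Rightarrow> real ^ 2) \<Rightarrow> real \<Rightarrow> real ^ 2" where
  "normal_vec f t = vector [- (nth_vderiv 1 f t $ 2), nth_vderiv 1 f t $ 1]"

definition curvature :: "(real \<Rightarrow> real ^ 2) \<Rightarrow> real \<Rightarrow> real" where
  "curvature f t = nth_vderiv 2 f t \<bullet> normal_vec f t"

definition rotation_number_one :: "real \<Rightarrow> (real \<Rightarrow> real ^ 2) \<Rightarrow> bool" where
  "rotation_number_one L f \<longleftrightarrow> integral {0..L} (curvature f) = 2 * pi"

definition signed_area :: "real \<Rightarrow> (real \<Rightarrow> real ^ 2) \<Rightarrow> real" where
  "signed_area L f = - (1 / 2) * integral {0..L} (\<lambda>t. f t \<bullet> normal_vec f t)"

definition curvature_dev :: "real \<Rightarrow> (real \<Rightarrow> real ^ 2) \<Rightarrow> real \<Rightarrow> real" where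
  "curvature_dev L f t = curvature f t - (1 / L) * integral {0..L} (curvature f)"

text \<open>\<open>I_iso\<close> is the quantity written $I_{-1}$, and \<open>I_curv l\<close> the one written $I_\ell$.\<close>

definition I_iso :: "real \<Rightarrow> (real \<Rightarrow> real ^ 2) \<Rightarrow> real" where
  "I_iso L f = 1 - 4 * pi * signed_area L f / L ^ 2"

definition I_curv :: "nat \<Rightarrow> real \<Rightarrow> (real \<Rightarrow> real ^ 2) \<Rightarrow> real" where
  "I_curv l L f =
     L ^ (2 * l + 1) * integral {0..L} (\<lambda>t. \<bar>nth_vderiv l (curvature_dev L f) t\<bar> ^ 2)"

text \<open>Real power of a nonnegative base with the convention $x^0 = 1$ also for $x = 0$,
  where \<open>powr\<close> has \<open>0 powr 0 = 0\<close>. The case matters: \<open>I_iso\<close> vanishes on circles.\<close>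

definition rpow :: "real \<Rightarrow> real \<Rightarrow> real" where
  "rpow x a = (if a = 0 then 1 else x powr a)"

end

theory Submission
  imports Defs
begin

text \<open>The inequality interpolates between the isoperimetric deficit \<open>I\<^sub>-\<^sub>1\<close>, which plays the role of a
  squared norm of negative order of the curvature deviation, and the energy \<open>I\<^sub>m\<close> of its \<open>m\<close>-th
  derivative. Everything rests on the single estimate
  \<open>I\<^sub>0 \<le> C I\<^sub>-\<^sub>1\<^sup>1\<^sup>/\<^sup>2 (I\<^sub>1\<^sup>1\<^sup>/\<^sup>2 + I\<^sub>1)\<close>.

  To see it, identify the plane with the complex numbers, place the centre of mass of the curve at the
  origin, put \<open>w = 2 \<pi> / L\<close>, and let \<open>q = \<kappa> - w\<close> be the curvature deviation. The function
  \<open>h = f' - i w f\<close> measures the distance to a circle. The sharp Wirtinger inequality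
  (\<open>Wirtinger_inequality\<close>) yields \<open>\<integral>|h|\<^sup>2 \<le> 2 L I\<^sub>-\<^sub>1\<close>, so the deficit controls \<open>h\<close>. Since
  \<open>h' = i q f'\<close>, one has \<open>\<integral>q\<^sup>2 = \<integral>|h'|\<^sup>2\<close>, and an integration by parts bounds this by the \<open>L\<^sup>2\<close> norm of
  \<open>h\<close> times that of \<open>h''\<close>. The latter has the components \<open>q'\<close> and \<open>\<kappa> q\<close>, and both are controlled
  by \<open>q'\<close>, because \<open>q\<close> has mean zero and rotation number one fixes the mean of \<open>\<kappa>\<close> to be \<open>w\<close>
  (\<open>frame_estimate\<close>).

  The general case is then formal. Integration by parts makes \<open>j \<mapsto> I\<^sub>j\<close> log-convex
  (\<open>scaled_derivative_energies_log_convex\<close>). Hence \<open>I\<^sub>1\<close> is bounded by powers of \<open>I\<^sub>0\<close> and \<open>I\<^sub>m\<close>;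
  absorbing \<open>I\<^sub>0\<close> settles the case \<open>l = 0\<close>, and a second interpolation between \<open>I\<^sub>0\<close> and \<open>I\<^sub>m\<close>
  gives every \<open>l\<close> (\<open>interpolation_from_first_order\<close>).\<close>

section \<open>Smooth functions of one variable\<close>

lemma nth_vderiv_0 [simp]: "nth_vderiv 0 f = f"
  by (simp add: nth_vderiv_def)

lemma nth_vderiv_Suc: "nth_vderiv (Suc n) f = (\<lambda>t. vector_derivative (nth_vderiv n f) (at t))"
  by (simp add: nth_vderiv_def)

lemma nth_vderiv_add: "nth_vderiv (m + n) f = nth_vderiv m (nth_vderiv n f)"
  by (simp add: nth_vderiv_def funpow_add)

lemma smooth_has_vderiv:
  assumes "smooth f"
  shows "(nth_vderiv n f has_vector_derivative nth_vderiv (Suc n) f t) (at t)"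
  using assms by (simp add: smooth_def nth_vderiv_Suc vector_derivative_works)

lemma nth_vderiv_Suc_eqI:
  assumes "\<And>t. (nth_vderiv n f has_vector_derivative g t) (at t)"
  shows "nth_vderiv (Suc n) f = g"
  using assms by (auto simp: nth_vderiv_Suc intro!: vector_derivative_at)

lemma smooth_nth_vderiv: "smooth f \<Longrightarrow> smooth (nth_vderiv n f)"
  by (auto simp: smooth_def simp flip: nth_vderiv_add)

lemma smooth_continuous_on: "smooth f \<Longrightarrow> continuous_on A (nth_vderiv n f)"
  by (intro continuous_at_imp_continuous_on ballI)
    (auto simp: smooth_def intro: differentiable_imp_continuous_within)

lemma nth_vderiv_periodic:
  assumes "smooth f" and "\<And>t. f (t + L) = f t"
  shows "nth_vderiv n f (t + L) = nth_vderiv n f t"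
proof (induction n arbitrary: t)
  case (Suc n)
  have "((\<lambda>s. s + L) has_vector_derivative 1) (at t)"
    by (auto intro!: derivative_eq_intros)
  then have "((nth_vderiv n f \<circ> (\<lambda>s. s + L)) has_vector_derivative 1 *\<^sub>R nth_vderiv (Suc n) f (t + L)) (at t)"
    by (rule vector_diff_chain_at) (rule smooth_has_vderiv[OF assms(1)])
  moreover have "nth_vderiv n f \<circ> (\<lambda>s. s + L) = nth_vderiv n f"
    using Suc by auto
  ultimately show ?case
    using vector_derivative_unique_at[OF _ smooth_has_vderiv[OF assms(1), of n t]] by simp
qed (simp add: assms)

lemma nth_vderiv_component:
  assumes "smooth f"
  shows "nth_vderiv n (\<lambda>t. f t $ i) = (\<lambda>t. nth_vderiv n f t $ i)"
proof (induction n)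
  case (Suc n)
  show ?case
    by (rule nth_vderiv_Suc_eqI)
      (use Suc smooth_has_vderiv[OF assms] in \<open>auto intro: bounded_linear.has_vector_derivative[OF bounded_linear_vec_nth]\<close>)
qed simp

lemma smooth_component: "smooth f \<Longrightarrow> smooth (\<lambda>t. f t $ i)"
  unfolding smooth_def
  by (auto simp: nth_vderiv_component smooth_def[symmetric]
      intro!: differentiableI_vector bounded_linear.has_vector_derivative[OF bounded_linear_vec_nth]
        smooth_has_vderiv)

text \<open>Differentiability of finite order makes the product rule usable in an induction: one
  derivative of a product costs one order and leaves products of functions of the lower order.
  Counting orders by \<open>k < n\<close> makes order zero vacuous, so that the base cases are trivial.\<close>
definition differentiable_upto :: "nat \<Rightarrow> (real \<Rightarrow> 'a::real_normed_vector) \<Rightarrow> bool" where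
  "differentiable_upto n f \<longleftrightarrow> (\<forall>k<n. \<forall>t. nth_vderiv k f differentiable (at t))"

lemma smooth_iff_differentiable_upto: "smooth f \<longleftrightarrow> (\<forall>n. differentiable_upto n f)"
  by (auto simp: smooth_def differentiable_upto_def)

lemma differentiable_upto_mono: "differentiable_upto n f \<Longrightarrow> m \<le> n \<Longrightarrow> differentiable_upto m f"
  by (auto simp: differentiable_upto_def)

lemma differentiable_upto_SucI:
  assumes "\<And>t. (f has_vector_derivative f' t) (at t)" "differentiable_upto n f'"
  shows "differentiable_upto (Suc n) f"
proof -
  have 1: "nth_vderiv 1 f = f'"
    using nth_vderiv_Suc_eqI[of 0 f f'] assms by simp
  show ?thesis
    unfolding differentiable_upto_def
  proof (intro allI impI)
    fix k t assume "k < Suc n"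
    then show "nth_vderiv k f differentiable at t"
    proof (cases k)
      case 0
      then show ?thesis using assms(1)[of t] by (auto simp: differentiableI_vector)
    next
      case (Suc j)
      then show ?thesis
        using assms(2) \<open>k < Suc n\<close> nth_vderiv_add[of j 1 f] 1 by (simp add: differentiable_upto_def)
    qed
  qed
qed

lemma differentiable_upto_SucD:
  assumes "differentiable_upto (Suc n) f"
  shows "(f has_vector_derivative nth_vderiv 1 f t) (at t)" "differentiable_upto n (nth_vderiv 1 f)"
proof -
  have "f differentiable at t" using assms by (auto simp: differentiable_upto_def)
  then show "(f has_vector_derivative nth_vderiv 1 f t) (at t)"
    by (simp add: nth_vderiv_Suc vector_derivative_works)
  show "differentiable_upto n (nth_vderiv 1 f)"
    using assms by (auto simp: differentiable_upto_def simp flip: nth_vderiv_add)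
qed

lemma differentiable_upto_diff:
  assumes "differentiable_upto n f" "differentiable_upto n g"
  shows "differentiable_upto n (\<lambda>t. f t - g t)"
  using assms
proof (induction n arbitrary: f g)
  case (Suc n)
  show ?case
    by (rule differentiable_upto_SucI[OF has_vector_derivative_diff Suc.IH])
      (use Suc.prems in \<open>auto dest: differentiable_upto_SucD\<close>)
qed (simp add: differentiable_upto_def)

lemma differentiable_upto_add:
  assumes "differentiable_upto n f" "differentiable_upto n g"
  shows "differentiable_upto n (\<lambda>t. f t + g t)"
  using assms
proof (induction n arbitrary: f g)
  case (Suc n)
  show ?case
    by (rule differentiable_upto_SucI[OF has_vector_derivative_add Suc.IH])
      (use Suc.prems in \<open>auto dest: differentiable_upto_SucD\<close>)
qed (simp add: differentiable_upto_def)

lemma differentiable_upto_mult: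
  fixes f g :: "real \<Rightarrow> real"
  assumes "differentiable_upto n f" "differentiable_upto n g"
  shows "differentiable_upto n (\<lambda>t. f t * g t)"
  using assms
proof (induction n arbitrary: f g)
  case (Suc n)
  have "differentiable_upto n f" "differentiable_upto n g"
    using Suc.prems differentiable_upto_mono le_SucI by blast+
  then show ?case
    using Suc.prems[THEN differentiable_upto_SucD(2)]
    by (intro differentiable_upto_SucI[OF has_vector_derivative_mult[OF
          Suc.prems(1)[THEN differentiable_upto_SucD(1)] Suc.prems(2)[THEN differentiable_upto_SucD(1)]]]
        differentiable_upto_add Suc.IH)
qed (simp add: differentiable_upto_def)

lemma smooth_diff: "smooth f \<Longrightarrow> smooth g \<Longrightarrow> smooth (\<lambda>t. f t - g t)"
  by (simp add: smooth_iff_differentiable_upto differentiable_upto_diff)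

lemma smooth_mult: "smooth f \<Longrightarrow> smooth g \<Longrightarrow> smooth (\<lambda>t. f t * g t)"
  for f g :: "real \<Rightarrow> real"
  by (simp add: smooth_iff_differentiable_upto differentiable_upto_mult)

lemma smooth_const: "smooth (\<lambda>t. c)"
proof -
  have "\<exists>d. nth_vderiv n (\<lambda>t::real. c) = (\<lambda>t. d)" for n
    by (induction n) (auto simp: nth_vderiv_Suc)
  then show ?thesis unfolding smooth_def by (metis differentiable_const)
qed

section \<open>Integral inequalities for periodic functions\<close>

text \<open>The quadratic form \<open>(r, s) \<mapsto> \<integral>(r f - s g)\<^sup>2\<close> is nonnegative, so its discriminant is not positive.\<close>
lemma integral_Cauchy_Schwarz:
  fixes f g :: "real \<Rightarrow> real"
  assumes "continuous_on {a..b} f" "continuous_on {a..b} g"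
  shows "(integral {a..b} (\<lambda>t. f t * g t))\<^sup>2
    \<le> integral {a..b} (\<lambda>t. (f t)\<^sup>2) * integral {a..b} (\<lambda>t. (g t)\<^sup>2)"
proof -
  define P Q R where "P = integral {a..b} (\<lambda>t. (f t)\<^sup>2)" and "Q = integral {a..b} (\<lambda>t. (g t)\<^sup>2)"
    and "R = integral {a..b} (\<lambda>t. f t * g t)"
  have i: "(\<lambda>t. (f t)\<^sup>2) integrable_on {a..b}" "(\<lambda>t. (g t)\<^sup>2) integrable_on {a..b}"
    "(\<lambda>t. f t * g t) integrable_on {a..b}"
    by (intro integrable_continuous_interval continuous_intros assms)+
  have q: "0 \<le> P * r\<^sup>2 - 2 * r * s * R + s\<^sup>2 * Q" for r s
  proof -
    have "((\<lambda>t. (f t)\<^sup>2 * r\<^sup>2 - (f t * g t) * (2 * r * s) + (g t)\<^sup>2 * s\<^sup>2) has_integral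
        P * r\<^sup>2 - R * (2 * r * s) + Q * s\<^sup>2) {a..b}"
      unfolding P_def Q_def R_def using i
      by (intro has_integral_add has_integral_diff has_integral_mult_left integrable_integral)
    moreover have "(f t)\<^sup>2 * r\<^sup>2 - (f t * g t) * (2 * r * s) + (g t)\<^sup>2 * s\<^sup>2 = (f t * r - g t * s)\<^sup>2" for t
      by algebra
    ultimately have "0 \<le> P * r\<^sup>2 - R * (2 * r * s) + Q * s\<^sup>2"
      using has_integral_nonneg[where S="{a..b}"] by fastforce
    then show ?thesis by (simp add: algebra_simps)
  qed
  have P: "P \<ge> 0" unfolding P_def by (intro integral_nonneg i) auto
  have "R\<^sup>2 \<le> P * Q"
  proof (cases "P = 0")
    case False
    \<comment> \<open>The choice \<open>r = R\<close>, \<open>s = P\<close> minimises the form.\<close>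
    have "0 \<le> P * (P * Q - R\<^sup>2)"
      using q[of R P] by (simp add: algebra_simps power2_eq_square)
    then show ?thesis using P False by (simp add: zero_le_mult_iff)
  next
    case True
    have "R = 0"
    proof (rule ccontr)
      assume "R \<noteq> 0"
      \<comment> \<open>The form is now affine in \<open>r\<close> with slope \<open>-2 R\<close>, and this \<open>r\<close> makes it negative.\<close>
      have "0 \<le> - 2 * ((Q + 1) / R) * R + Q"
        using q[of "(Q + 1) / R" 1] True by (simp del: times_divide_eq_left times_divide_eq_right)
      also have "\<dots> = - Q - 2" using \<open>R \<noteq> 0\<close> by (simp add: field_simps)
      finally show False using integral_nonneg[OF i(2)] Q_def by simp
    qed
    then show ?thesis using True by simp
  qed
  then show ?thesis by (simp add: P_def Q_def R_def)
qed

lemma integral_by_parts_periodic: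
  fixes u v u' v' :: "real \<Rightarrow> real"
  assumes "L > 0" and "\<And>t. (u has_real_derivative u' t) (at t)" "\<And>t. (v has_real_derivative v' t) (at t)"
    and "continuous_on {0..L} u'" "continuous_on {0..L} v'"
    and "u L = u 0" "v L = v 0"
  shows "integral {0..L} (\<lambda>t. u t * v' t) = - integral {0..L} (\<lambda>t. u' t * v t)"
proof -
  have c: "continuous_on {0..L} u" "continuous_on {0..L} v"
    by (rule DERIV_continuous_on[OF has_field_derivative_at_within[OF assms(2)]]
        DERIV_continuous_on[OF has_field_derivative_at_within[OF assms(3)]])+
  have "((\<lambda>t. u t * v t) has_vector_derivative u t * v' t + u' t * v t) (at t within {0..L})" for t
    using DERIV_mult'[OF assms(2)[of t] assms(3)[of t]]
    by (simp add: has_real_derivative_iff_has_vector_derivative has_vector_derivative_at_within)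
  then have "((\<lambda>t. u t * v' t + u' t * v t) has_integral u L * v L - u 0 * v 0) {0..L}"
    using \<open>L > 0\<close> by (intro fundamental_theorem_of_calculus) auto
  then have "integral {0..L} (\<lambda>t. u t * v' t + u' t * v t) = 0"
    using assms(6,7) by (simp add: integral_unique)
  moreover have "integral {0..L} (\<lambda>t. u t * v' t + u' t * v t) =
      integral {0..L} (\<lambda>t. u t * v' t) + integral {0..L} (\<lambda>t. u' t * v t)"
    by (intro integral_add integrable_continuous_interval continuous_on_mult c assms)
  ultimately show ?thesis by simp
qed

text \<open>A continuous function of mean zero vanishes somewhere; the fundamental theorem of calculus from
  that point and the Cauchy-Schwarz inequality give the bound.\<close>
lemma sup_bound_mean_zero:
  fixes u u' :: "real \<Rightarrow> real"
  assumes "L > 0" and du: "\<And>t. (u has_real_derivative u' t) (at t)" and "continuous_on {0..L} u'"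
    and "integral {0..L} u = 0" and s: "s \<in> {0..L}"
  shows "(u s)\<^sup>2 \<le> L * integral {0..L} (\<lambda>t. (u' t)\<^sup>2)"
proof -
  have c: "continuous_on {0..L} u"
    by (rule DERIV_continuous_on[OF has_field_derivative_at_within[OF du]])
  obtain r where r: "r \<in> {0..L}" "u r = 0"
  proof -
    have "\<exists>p\<in>{0..L}. u p \<le> 0"
    proof (rule ccontr)
      assume "\<not> ?thesis"
      then have "integral {0..L} (\<lambda>t. 0) < integral {0..L} u"
        using \<open>L > 0\<close> c by (intro integral_less_real) (auto simp: not_le)
      then show False using assms by simp
    qed
    then obtain p where p: "p \<in> {0..L}" "u p \<le> 0" by auto
    have "\<exists>q\<in>{0..L}. u q \<ge> 0"
    proof (rule ccontr)
      assume "\<not> ?thesis"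
      then have "integral {0..L} u < integral {0..L} (\<lambda>t. 0)"
        using \<open>L > 0\<close> c by (intro integral_less_real) (auto simp: not_le)
      then show False using assms by simp
    qed
    then obtain q where q: "q \<in> {0..L}" "u q \<ge> 0" by auto
    have "connected (u ` {0..L})" by (intro connected_continuous_image c) auto
    moreover have "u p \<in> u ` {0..L}" "u q \<in> u ` {0..L}" using p q by simp_all
    ultimately have "0 \<in> u ` {0..L}"
      using p(2) q(2) unfolding connected_iff_interval by metis
    then obtain r where "r \<in> {0..L}" "0 = u r" by (rule imageE)
    then show ?thesis using that by simp
  qed
  have B: "(u s)\<^sup>2 \<le> L * integral {0..L} (\<lambda>t. (u' t)\<^sup>2)"
    if "a \<le> b" "{a..b} \<subseteq> {0..L}" "(u b - u a)\<^sup>2 = (u s)\<^sup>2" for a b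
  proof -
    have ca: "continuous_on {a..b} u'" by (rule continuous_on_subset[OF assms(3) that(2)])
    have "(u' has_integral u b - u a) {a..b}"
      using du that(1) by (intro fundamental_theorem_of_calculus)
        (auto simp: has_real_derivative_iff_has_vector_derivative has_vector_derivative_at_within)
    then have "(u s)\<^sup>2 = (integral {a..b} (\<lambda>t. 1 * u' t))\<^sup>2"
      using that by (simp add: integral_unique)
    also have "\<dots> \<le> integral {a..b} (\<lambda>t. 1\<^sup>2) * integral {a..b} (\<lambda>t. (u' t)\<^sup>2)"
      using integral_Cauchy_Schwarz[of a b "\<lambda>_. 1" u'] ca by simp
    also have "\<dots> \<le> L * integral {0..L} (\<lambda>t. (u' t)\<^sup>2)"
    proof (rule mult_mono)
      show "integral {a..b} (\<lambda>t. 1\<^sup>2) \<le> L" using that(1,2) by auto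
      show "integral {a..b} (\<lambda>t. (u' t)\<^sup>2) \<le> integral {0..L} (\<lambda>t. (u' t)\<^sup>2)"
        by (intro integral_subset_le that integrable_continuous_interval continuous_intros ca assms(3)) auto
      show "0 \<le> integral {a..b} (\<lambda>t. (u' t)\<^sup>2)"
        by (intro integral_nonneg integrable_continuous_interval continuous_intros ca) auto
    qed (use \<open>L > 0\<close> in auto)
    finally show ?thesis .
  qed
  show ?thesis
  proof (cases "r \<le> s")
    case True then show ?thesis using r s by (intro B[of r s]) auto
  next
    case False then show ?thesis using r s by (intro B[of s r]) auto
  qed
qed

section \<open>The sharp Wirtinger inequality\<close>

text \<open>The double zero of \<open>v\<^sup>2\<close> beats the simple zero of \<open>s\<close>. Since \<open>x / 0 = 0\<close>, the quotient already
  has the right value at \<open>p\<close>.\<close>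
lemma isCont_square_cot_at_common_zero:
  fixes v s :: "real \<Rightarrow> real"
  assumes "(v has_real_derivative v') (at p)" "(s has_real_derivative s') (at p)"
    and "v p = 0" "s p = 0" "s' \<noteq> 0" "isCont c p"
  shows "isCont (\<lambda>t. (v t)\<^sup>2 * (c t / s t)) p"
proof -
  have q: "((\<lambda>t. v t / (t - p)) \<longlongrightarrow> v') (at p)" "((\<lambda>t. s t / (t - p)) \<longlongrightarrow> s') (at p)"
    using assms(1-4) by (simp_all add: has_field_derivative_iff)
  have v: "(v \<longlongrightarrow> 0) (at p)"
    using DERIV_isCont[OF assms(1)] assms(3) by (simp add: isCont_def)
  have "((\<lambda>t. v t * ((v t / (t - p)) / (s t / (t - p))) * c t) \<longlongrightarrow> 0 * (v' / s') * c p) (at p)"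
    using assms(5,6) by (intro tendsto_mult tendsto_divide q v) (auto simp: isCont_def)
  moreover have "\<forall>\<^sub>F t in at p. v t * ((v t / (t - p)) / (s t / (t - p))) * c t = (v t)\<^sup>2 * (c t / s t)"
    by (auto simp: eventually_at_filter power2_eq_square)
  ultimately show ?thesis
    using assms(3) Lim_transform_eventually by (fastforce simp: isCont_def)
qed

text \<open>The increment of \<open>u\<close> over half a period changes sign when shifted by half a period.\<close>
lemma periodic_half_period_coincidence:
  fixes u :: "real \<Rightarrow> real"
  assumes "L > 0" "continuous_on {0..L} u" "u L = u 0"
  obtains a where "0 \<le> a" "a \<le> L / 2" "u (a + L / 2) = u a"
proof -
  define d where "d = (\<lambda>t. u (t + L / 2) - u t)"
  have cd: "continuous_on {0..L/2} d"
    unfolding d_def using assms(1)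
    by (intro continuous_on_diff continuous_on_compose2[OF assms(2)] continuous_intros) auto
  have "d (L / 2) = - d 0" using assms by (simp add: d_def)
  then have "\<exists>a\<ge>0. a \<le> L / 2 \<and> d a = 0"
    using assms(1) IVT'[OF _ _ _ cd, of 0] IVT2'[OF _ _ _ cd, of 0] by (cases "d 0 \<le> 0") auto
  then show thesis using that by (auto simp: d_def)
qed

text \<open>The sharp constant is essential: with a larger one, the bound for the distance to circles would
  not vanish together with the isoperimetric deficit. It can be had without Fourier series. Put
  \<open>w = 2 \<pi> / L\<close> and choose \<open>a\<close> with \<open>u (a + L / 2) = u a\<close>. Then \<open>v = u - u a\<close> vanishes at every zero of
  \<open>sin (w (t - a))\<close>, so that \<open>F = w v\<^sup>2 cot (w (t - a))\<close> is continuous and periodic, and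
  \<open>F' = u'\<^sup>2 - w\<^sup>2 v\<^sup>2 - (u' - w v cot (w (t - a)))\<^sup>2\<close>. Integrating over a period gives
  \<open>w\<^sup>2 \<integral>v\<^sup>2 \<le> \<integral>u'\<^sup>2\<close>, and \<open>\<integral>u\<^sup>2 \<le> \<integral>v\<^sup>2\<close> because \<open>u\<close> has mean zero.\<close>
lemma Wirtinger_inequality:
  fixes u u' :: "real \<Rightarrow> real"
  assumes L: "L > 0" and du: "\<And>t. (u has_real_derivative u' t) (at t)" and cu: "continuous_on {0..L} u'"
    and per: "\<And>t. u (t + L) = u t" and mean: "integral {0..L} u = 0"
  shows "(2 * pi / L)\<^sup>2 * integral {0..L} (\<lambda>t. (u t)\<^sup>2) \<le> integral {0..L} (\<lambda>t. (u' t)\<^sup>2)"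
proof -
  define w where "w = 2 * pi / L"
  have w: "w > 0" "w * L = 2 * pi" using L by (simp_all add: w_def)
  have c: "continuous_on {0..L} u"
    by (rule DERIV_continuous_on[OF has_field_derivative_at_within[OF du]])
  obtain a where a: "0 \<le> a" "a \<le> L / 2" "u (a + L / 2) = u a"
    using periodic_half_period_coincidence[OF L c] per[of 0] by auto
  define v where "v = (\<lambda>t. u t - u a)"
  have dv: "(v has_real_derivative u' t) (at t)" for t
    unfolding v_def using DERIV_diff[OF du DERIV_const] by simp
  define ct where "ct = (\<lambda>t. cos (w * (t - a)) / sin (w * (t - a)))"
  define F where "F = (\<lambda>t. (v t)\<^sup>2 * (w * cos (w * (t - a)) / sin (w * (t - a))))"
  define G where "G = (\<lambda>t. (u' t)\<^sup>2 - w\<^sup>2 * (v t)\<^sup>2 - (u' t - w * v t * ct t)\<^sup>2)"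
  define S where "S = {a - L / 2, a, a + L / 2, a + L}"
  \<comment> \<open>As \<open>t - a\<close> lies between \<open>- L / 2\<close> and \<open>L\<close>, four multiples of half a period can occur.\<close>
  have zeros: "t \<in> S" if t: "t \<in> {0..L}" "sin (w * (t - a)) = 0" for t
  proof -
    obtain i :: int where "w * (t - a) = of_int i * pi"
      using t(2) by (auto simp: sin_zero_iff_int2)
    moreover have "pi = w * (L / 2)" using w by simp
    ultimately have "w * (t - a) = w * (of_int i * (L / 2))" by simp
    then have i: "t - a = of_int i * (L / 2)" using w by simp
    have "of_int i * (L / 2) \<le> 2 * (L / 2)" "-1 * (L / 2) \<le> of_int i * (L / 2)"
      using t a i by auto
    then have "of_int i \<le> (2 :: real)" "(-1 :: real) \<le> of_int i"
      using L mult_le_cancel_right_pos[of "L / 2" "of_int i" 2]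
        mult_le_cancel_right_pos[of "L / 2" "-1" "of_int i"] by linarith+
    then have "i = -1 \<or> i = 0 \<or> i = 1 \<or> i = 2" by linarith
    then show ?thesis using i by (auto simp: S_def)
  qed
  have vS: "v t = 0" if "t \<in> S" for t
    using that a(3) per[of a] per[of "a - L / 2"] by (auto simp: S_def v_def add.commute)
  have dF: "(F has_real_derivative G t) (at t)" if "sin (w * (t - a)) \<noteq> 0" for t
  proof -
    define si co where "si = sin (w * (t - a))" and "co = cos (w * (t - a))"
    have sc: "si \<noteq> 0" "si\<^sup>2 + co\<^sup>2 = 1" using that by (simp_all add: si_def co_def)
    have "(F has_real_derivative
        2 * v t * u' t * (w * co / si) + (v t)\<^sup>2 * ((w * (- si * w) * si - w * co * (co * w)) / si\<^sup>2)) (at t)"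
      unfolding F_def using that
      by (auto intro!: derivative_eq_intros dv simp: si_def co_def power2_eq_square)
        (simp add: field_simps)
    also have "(w * (- si * w) * si - w * co * (co * w)) / si\<^sup>2 = - w\<^sup>2 * (si\<^sup>2 + co\<^sup>2) / si\<^sup>2"
      by (simp add: algebra_simps power2_eq_square)
    also have "\<dots> = - w\<^sup>2 - w\<^sup>2 * (co / si)\<^sup>2"
      using sc(1) by (simp add: field_simps)
    also have "2 * v t * u' t * (w * co / si) + (v t)\<^sup>2 * (- w\<^sup>2 - w\<^sup>2 * (co / si)\<^sup>2) = G t"
      unfolding G_def ct_def si_def[symmetric] co_def[symmetric]
      by (simp add: power2_eq_square algebra_simps)
    finally show ?thesis .
  qed
  have cF: "isCont F t" if "t \<in> {0..L}" for t
  proof (cases "sin (w * (t - a)) = 0")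
    case True
    then have "v t = 0" using zeros vS that by blast
    moreover have "cos (w * (t - a)) \<noteq> 0" using True sin_cos_squared_add[of "w * (t - a)"] by auto
    ultimately show ?thesis
      unfolding F_def using True w
      by (intro isCont_square_cot_at_common_zero[OF dv, where s' = "cos (w * (t - a)) * w"])
        (auto intro!: derivative_eq_intros)
  next
    case False
    then show ?thesis using dF DERIV_isCont by blast
  qed
  have "(G has_integral F L - F 0) {0..L}"
  proof (rule fundamental_theorem_of_calculus_interior_strong[of S])
    show "finite S" by (simp add: S_def)
    show "continuous_on {0..L} F" using cF by (intro continuous_at_imp_continuous_on) auto
    show "(F has_vector_derivative G t) (at t)" if "t \<in> {0<..<L} - S" for t
      using that zeros[of t] dF[of t] by (auto simp: has_real_derivative_iff_has_vector_derivative)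
  qed (use L in simp)
  moreover have "F L = F 0"
  proof -
    have "w * (L - a) = w * (0 - a) + 2 * pi" using w by (simp add: algebra_simps)
    then have "cos (w * (L - a)) = cos (w * (0 - a))" "sin (w * (L - a)) = sin (w * (0 - a))"
      by (metis cos_periodic, metis sin_periodic)
    then show ?thesis using per[of 0] by (simp add: F_def v_def)
  qed
  ultimately have G: "(G has_integral 0) {0..L}" by simp
  have i: "u integrable_on {0..L}" "(\<lambda>t. (u t)\<^sup>2) integrable_on {0..L}" "(\<lambda>t. (u' t)\<^sup>2) integrable_on {0..L}"
    by (intro integrable_continuous_interval continuous_intros c cu)+
  have "((\<lambda>t. (u t)\<^sup>2 - 2 * u a * u t + (u a)\<^sup>2) has_integral
      integral {0..L} (\<lambda>t. (u t)\<^sup>2) - 2 * u a * 0 + (u a)\<^sup>2 * L) {0..L}"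
    using i mean has_integral_const_real[of "(u a)\<^sup>2" 0 L] L
    by (intro has_integral_add has_integral_diff has_integral_mult_right)
      (auto simp: has_integral_iff mult.commute)
  moreover have "(\<lambda>t. (u t)\<^sup>2 - 2 * u a * u t + (u a)\<^sup>2) = (\<lambda>t. (v t)\<^sup>2)"
    by (auto simp: v_def power2_eq_square algebra_simps)
  ultimately have V: "((\<lambda>t. (v t)\<^sup>2) has_integral integral {0..L} (\<lambda>t. (u t)\<^sup>2) + (u a)\<^sup>2 * L) {0..L}"
    by simp
  have "((\<lambda>t. (u' t)\<^sup>2 - w\<^sup>2 * (v t)\<^sup>2) has_integral
      integral {0..L} (\<lambda>t. (u' t)\<^sup>2) - w\<^sup>2 * (integral {0..L} (\<lambda>t. (u t)\<^sup>2) + (u a)\<^sup>2 * L)) {0..L}"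
    by (intro has_integral_diff has_integral_mult_right V integrable_integral i)
  from has_integral_le[OF G this]
  have "w\<^sup>2 * (integral {0..L} (\<lambda>t. (u t)\<^sup>2) + (u a)\<^sup>2 * L) \<le> integral {0..L} (\<lambda>t. (u' t)\<^sup>2)"
    by (simp add: G_def)
  moreover have "0 \<le> w\<^sup>2 * ((u a)\<^sup>2 * L)" using L by simp
  ultimately show ?thesis unfolding w_def[symmetric] by (simp add: algebra_simps)
qed

section \<open>The deficit controls the curvature deviation\<close>

text \<open>Here \<open>(x, y)\<close> is a unit-speed closed curve with centre of mass at the origin, \<open>w + q\<close> is its
  curvature and \<open>J\<close> its isoperimetric deficit. In complex notation let \<open>h = f' - i w f\<close>, which vanishes
  on the positively oriented circle of length \<open>L\<close> around the origin; \<open>Q\<close> and \<open>- P\<close> are its components along the tangent and the normal.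
  Expanding \<open>|h|\<^sup>2\<close> and using the sharp Wirtinger inequality for \<open>x\<close> and \<open>y\<close> gives \<open>\<integral>|h|\<^sup>2 \<le> 2 L J\<close>.
  On the other hand, \<open>h' = i q f'\<close> means in the moving frame that \<open>P' = (w + q) Q - q\<close>. Multiplying by
  \<open>q\<close> and integrating by parts, \<open>\<integral>q\<^sup>2 = \<integral>q (w + q) Q + \<integral>q' P\<close>, which the Cauchy-Schwarz inequality
  bounds by the \<open>L\<^sup>2\<close> norm of \<open>h\<close>. The factor \<open>q (w + q)\<close> is controlled through the supremum of \<open>q\<close>,
  hence through \<open>q'\<close>; this is where the term \<open>r\<^sup>2\<close> comes from.\<close>
lemma frame_estimate:
  fixes x y x' y' q q' :: "real \<Rightarrow> real" and L :: real
  defines "w \<equiv> 2 * pi / L"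
  assumes L: "L > 0"
    and dx: "\<And>t. (x has_real_derivative x' t) (at t)" and dy: "\<And>t. (y has_real_derivative y' t) (at t)"
    and dx': "\<And>t. (x' has_real_derivative - (w + q t) * y' t) (at t)"
    and dy': "\<And>t. (y' has_real_derivative (w + q t) * x' t) (at t)"
    and dq: "\<And>t. (q has_real_derivative q' t) (at t)" and cq': "continuous_on {0..L} q'"
    and unit: "\<And>t. (x' t)\<^sup>2 + (y' t)\<^sup>2 = 1"
    and per: "\<And>t. x (t + L) = x t" "\<And>t. y (t + L) = y t" "\<And>t. x' (t + L) = x' t"
      "\<And>t. y' (t + L) = y' t" "\<And>t. q (t + L) = q t"
    and mean: "integral {0..L} x = 0" "integral {0..L} y = 0" "integral {0..L} q = 0"
  defines "J \<equiv> 1 - w / L * integral {0..L} (\<lambda>t. x t * y' t - y t * x' t)"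
    and "r \<equiv> sqrt (L ^ 3 * integral {0..L} (\<lambda>t. (q' t)\<^sup>2))"
  shows "0 \<le> J" "L * integral {0..L} (\<lambda>t. (q t)\<^sup>2) \<le> sqrt 2 * (1 + 2 * pi) * sqrt J * (r + r\<^sup>2)"
proof -
  have w: "w > 0" "w * L = 2 * pi" using L by (simp_all add: w_def)
  have c: "continuous_on {0..L} x" "continuous_on {0..L} y" "continuous_on {0..L} x'"
    "continuous_on {0..L} y'" "continuous_on {0..L} q"
    by (rule DERIV_continuous_on[OF has_field_derivative_at_within[OF dx]]
        DERIV_continuous_on[OF has_field_derivative_at_within[OF dy]]
        DERIV_continuous_on[OF has_field_derivative_at_within[OF dx']]
        DERIV_continuous_on[OF has_field_derivative_at_within[OF dy']]
        DERIV_continuous_on[OF has_field_derivative_at_within[OF dq]])+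
  note ci = integrable_continuous_interval continuous_intros c cq'
  define P where "P = (\<lambda>t. w * (x t * x' t + y t * y' t))"
  define Q where "Q = (\<lambda>t. 1 + w * (y t * x' t - x t * y' t))"
  have cPQ: "continuous_on {0..L} P" "continuous_on {0..L} Q"
    unfolding P_def Q_def by (intro ci)+
  have dP: "(P has_real_derivative (w + q t) * Q t - q t) (at t)" for t
  proof -
    have "(P has_real_derivative w * (x t * (- (w + q t) * y' t) + x' t * x' t
        + (y t * ((w + q t) * x' t) + y' t * y' t))) (at t)"
      unfolding P_def
      by (intro DERIV_cmult DERIV_add DERIV_mult' dx dy dx' dy')
    also have "w * (x t * (- (w + q t) * y' t) + x' t * x' t + (y t * ((w + q t) * x' t) + y' t * y' t))
        = (w + q t) * Q t - q t + w * ((x' t)\<^sup>2 + (y' t)\<^sup>2 - 1)"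
      unfolding Q_def by (simp add: power2_eq_square algebra_simps)
    finally show ?thesis using unit by simp
  qed
  define B where "B = integral {0..L} (\<lambda>t. x t * y' t - y t * x' t)"
  have LJ: "L * J = L - w * B" using L by (simp add: J_def B_def field_simps)
  define H where "H = integral {0..L} (\<lambda>t. (P t)\<^sup>2) + integral {0..L} (\<lambda>t. (Q t)\<^sup>2)"
  have PQ: "(P t)\<^sup>2 + (Q t)\<^sup>2 = 1 - 2 * w * (x t * y' t - y t * x' t) + w\<^sup>2 * ((x t)\<^sup>2 + (y t)\<^sup>2)" for t
  proof -
    have "(P t)\<^sup>2 + (Q t)\<^sup>2 = 1 - 2 * w * (x t * y' t - y t * x' t)
        + w\<^sup>2 * (((x t)\<^sup>2 + (y t)\<^sup>2) * ((x' t)\<^sup>2 + (y' t)\<^sup>2))"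
      unfolding P_def Q_def by (simp add: power2_eq_square algebra_simps)
    then show ?thesis by (simp add: unit)
  qed
  have wx: "w\<^sup>2 * integral {0..L} (\<lambda>t. (x t)\<^sup>2) \<le> integral {0..L} (\<lambda>t. (x' t)\<^sup>2)"
    unfolding w_def by (intro Wirtinger_inequality L dx c per mean)
  have wy: "w\<^sup>2 * integral {0..L} (\<lambda>t. (y t)\<^sup>2) \<le> integral {0..L} (\<lambda>t. (y' t)\<^sup>2)"
    unfolding w_def by (intro Wirtinger_inequality L dy c per mean)
  have "integral {0..L} (\<lambda>t. (x' t)\<^sup>2) + integral {0..L} (\<lambda>t. (y' t)\<^sup>2)
      = integral {0..L} (\<lambda>t. (x' t)\<^sup>2 + (y' t)\<^sup>2)"
    by (intro integral_add[symmetric] ci)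
  also have "\<dots> = L" using L by (simp add: unit)
  finally have W: "w\<^sup>2 * (integral {0..L} (\<lambda>t. (x t)\<^sup>2) + integral {0..L} (\<lambda>t. (y t)\<^sup>2)) \<le> L"
    using wx wy by (simp add: algebra_simps)
  have i: "(\<lambda>t. (x t)\<^sup>2) integrable_on {0..L}" "(\<lambda>t. (y t)\<^sup>2) integrable_on {0..L}"
    "(\<lambda>t. x t * y' t - y t * x' t) integrable_on {0..L}" by (intro ci)+
  have "H = integral {0..L} (\<lambda>t. (P t)\<^sup>2 + (Q t)\<^sup>2)"
    unfolding H_def by (intro integral_add[symmetric] integrable_continuous_interval continuous_intros cPQ)
  also have "\<dots> = L - 2 * w * B
      + w\<^sup>2 * (integral {0..L} (\<lambda>t. (x t)\<^sup>2) + integral {0..L} (\<lambda>t. (y t)\<^sup>2))"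
    unfolding PQ B_def using has_integral_const_real[of "1::real" 0 L] L i
    by (intro integral_unique has_integral_add has_integral_diff has_integral_mult_right integrable_integral) auto
  finally have HJ: "H \<le> 2 * (L * J)" using W LJ by simp
  have H0: "0 \<le> integral {0..L} (\<lambda>t. (P t)\<^sup>2)" "0 \<le> integral {0..L} (\<lambda>t. (Q t)\<^sup>2)"
    by (intro integral_nonneg integrable_continuous_interval continuous_intros cPQ; simp)+
  then have "0 \<le> L * J" using HJ by (simp add: H_def)
  then show J: "0 \<le> J" using L by (simp add: zero_le_mult_iff)
  define K where "K = integral {0..L} (\<lambda>t. (q' t)\<^sup>2)"
  have K: "0 \<le> K" unfolding K_def by (intro integral_nonneg ci; simp)
  define M where "M = r / L"
  have r: "0 \<le> r" "r\<^sup>2 = L ^ 3 * K" using K L by (simp_all add: r_def K_def)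
  have M: "0 \<le> M" "M\<^sup>2 = L * K"
    using r L by (simp_all add: M_def power_divide) (simp add: power2_eq_square power3_eq_cube)
  have qM: "\<bar>q t\<bar> \<le> M" if "t \<in> {0..L}" for t
  proof -
    have "(q t)\<^sup>2 \<le> M\<^sup>2"
      using sup_bound_mean_zero[OF L dq cq' mean(3) that] unfolding M(2) K_def .
    then show ?thesis using M(1) abs_le_square_iff[of "q t" M] by simp
  qed
  have ik: "integral {0..L} (\<lambda>t. (q t * (w + q t))\<^sup>2) \<le> L * (M * (w + M))\<^sup>2"
  proof -
    have "integral {0..L} (\<lambda>t. (q t * (w + q t))\<^sup>2) \<le> integral {0..L} (\<lambda>t. (M * (w + M))\<^sup>2)"
    proof (intro integral_le ci)
      fix t assume "t \<in> {0..L}"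
      then have "\<bar>q t * (w + q t)\<bar> \<le> M * (w + M)"
        unfolding abs_mult using qM[of t] w M by (intro mult_mono) auto
      then show "(q t * (w + q t))\<^sup>2 \<le> (M * (w + M))\<^sup>2" by (metis abs_ge_zero power2_abs power_mono)
    qed
    then show ?thesis using L by simp
  qed
  have "integral {0..L} (\<lambda>t. q t * ((w + q t) * Q t - q t)) = - integral {0..L} (\<lambda>t. q' t * P t)"
    using per(1-4)[of 0] per(5)[of 0]
    by (intro integral_by_parts_periodic L dq dP continuous_intros c cq' cPQ) (auto simp: P_def)
  moreover have "integral {0..L} (\<lambda>t. q t * ((w + q t) * Q t - q t))
      = integral {0..L} (\<lambda>t. (q t * (w + q t)) * Q t - (q t)\<^sup>2)"
    by (simp add: algebra_simps power2_eq_square)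
  moreover have "\<dots> = integral {0..L} (\<lambda>t. (q t * (w + q t)) * Q t) - integral {0..L} (\<lambda>t. (q t)\<^sup>2)"
    by (intro integral_diff ci cPQ)
  ultimately have E: "integral {0..L} (\<lambda>t. (q t)\<^sup>2)
      = integral {0..L} (\<lambda>t. (q t * (w + q t)) * Q t) + integral {0..L} (\<lambda>t. q' t * P t)"
    by simp
  have "(integral {0..L} (\<lambda>t. q' t * P t))\<^sup>2 \<le> K * integral {0..L} (\<lambda>t. (P t)\<^sup>2)"
    unfolding K_def by (intro integral_Cauchy_Schwarz cq' cPQ)
  also have "\<dots> \<le> K * (2 * (L * J))" using HJ H0 K by (intro mult_left_mono) (auto simp: H_def)
  also have "\<dots> = r\<^sup>2 / L\<^sup>2 * (2 * J)"
    unfolding r(2) using L by (simp add: field_simps power2_eq_square power3_eq_cube)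
  also have "\<dots> = (r / L * sqrt (2 * J))\<^sup>2"
    using J by (simp add: power_mult_distrib power_divide)
  finally have E1: "integral {0..L} (\<lambda>t. q' t * P t) \<le> r / L * sqrt (2 * J)"
    by (rule power2_le_imp_le) (use r(1) J L in simp)
  have "(integral {0..L} (\<lambda>t. (q t * (w + q t)) * Q t))\<^sup>2
      \<le> integral {0..L} (\<lambda>t. (q t * (w + q t))\<^sup>2) * integral {0..L} (\<lambda>t. (Q t)\<^sup>2)"
    by (intro integral_Cauchy_Schwarz cPQ continuous_intros c)
  also have "\<dots> \<le> (L * (M * (w + M))\<^sup>2) * (2 * (L * J))"
    using HJ H0 ik L by (intro mult_mono) (auto simp: H_def)
  also have "\<dots> = (L * (M * (w + M)) * sqrt (2 * J))\<^sup>2"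
    using J by (simp add: power_mult_distrib power2_eq_square)
  finally have E2: "integral {0..L} (\<lambda>t. (q t * (w + q t)) * Q t) \<le> L * (M * (w + M)) * sqrt (2 * J)"
    by (rule power2_le_imp_le) (use M(1) w(1) J L in simp)
  have "L * integral {0..L} (\<lambda>t. (q t)\<^sup>2) \<le> L * (L * (M * (w + M)) * sqrt (2 * J) + r / L * sqrt (2 * J))"
    unfolding E by (intro mult_left_mono add_mono E1 E2 less_imp_le[OF L])
  also have "\<dots> = ((L * M) * (w * L + L * M) + L * (r / L)) * sqrt (2 * J)" 
    by (simp only: distrib_left distrib_right mult_ac)
  also have "\<dots> = (r * (2 * pi + r) + r) * sqrt (2 * J)" using L unfolding w(2) M_def by simp
  also have "\<dots> \<le> ((1 + 2 * pi) * (r + r\<^sup>2)) * sqrt (2 * J)"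
    using r(1) J by (intro mult_right_mono) (auto simp: algebra_simps power2_eq_square)
  finally show "L * integral {0..L} (\<lambda>t. (q t)\<^sup>2) \<le> sqrt 2 * (1 + 2 * pi) * sqrt J * (r + r\<^sup>2)"
    by (simp only: real_sqrt_mult mult_ac)
qed

section \<open>Log-convexity of the derivative energies\<close>

text \<open>Formally \<open>a l \<le> a 0 powr (1 - l / m) * a m powr (l / m)\<close>; natural exponents keep the statement
  meaningful when some \<open>a j\<close> vanish. The proof first compares neighbours with \<open>a 0\<close>, which needs a
  division by a power of \<open>a (Suc j)\<close>, and then increases \<open>m\<close> one step at a time.\<close>
lemma log_convex_sequence_interpolation:
  fixes a :: "nat \<Rightarrow> real"
  assumes nonneg: "\<And>j. 0 \<le> a j" and logconv: "\<And>j. (a (Suc j))\<^sup>2 \<le> a j * a (Suc (Suc j))"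
    and "l \<le> m"
  shows "a l ^ m \<le> a 0 ^ (m - l) * a m ^ l"
proof -
  have step: "a j ^ Suc j \<le> a 0 * a (Suc j) ^ j" for j
  proof (induction j)
    case (Suc j)
    show ?case
    proof (cases "a (Suc j) = 0")
      case False
      then have pos: "a (Suc j) ^ j > 0" using nonneg[of "Suc j"] by simp
      have "a (Suc j) ^ j * a (Suc j) ^ Suc (Suc j) = ((a (Suc j))\<^sup>2) ^ Suc j"
        by (simp add: mult_2 flip: power_add power_mult)
      also have "\<dots> \<le> (a j * a (Suc (Suc j))) ^ Suc j"
        by (intro power_mono logconv) simp
      also have "\<dots> = a j ^ Suc j * a (Suc (Suc j)) ^ Suc j" by (rule power_mult_distrib)
      also have "\<dots> \<le> (a 0 * a (Suc j) ^ j) * a (Suc (Suc j)) ^ Suc j"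
        by (intro mult_right_mono Suc.IH zero_le_power nonneg)
      also have "\<dots> = a (Suc j) ^ j * (a 0 * a (Suc (Suc j)) ^ Suc j)" by (simp only: mult_ac)
      finally show ?thesis using pos by (rule mult_left_le_imp_le)
    qed (use nonneg in simp)
  qed simp
  show ?thesis using \<open>l \<le> m\<close>
  proof (induction m rule: dec_induct)
    case (step m)
    show ?case
    proof (cases "m = 0")
      case True
      then show ?thesis using step by simp
    next
      case False
      have "(a l ^ Suc m) ^ m = (a l ^ m) ^ Suc m"
        by (simp only: power_mult[symmetric] mult.commute[of "Suc m" m])
      also have "\<dots> \<le> (a 0 ^ (m - l) * a m ^ l) ^ Suc m"
        by (intro power_mono step.IH zero_le_power nonneg)
      also have "\<dots> = a 0 ^ ((m - l) * Suc m) * (a m ^ Suc m) ^ l"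
        by (simp only: power_mult_distrib power_mult[symmetric] mult.commute[of l "Suc m"])
      also have "\<dots> \<le> a 0 ^ ((m - l) * Suc m) * (a 0 * a (Suc m) ^ m) ^ l"
        using \<open>\<And>j. a j ^ Suc j \<le> a 0 * a (Suc j) ^ j\<close>
        by (intro mult_left_mono power_mono zero_le_power nonneg) auto
      also have "\<dots> = a 0 ^ ((m - l) * Suc m + l) * a (Suc m) ^ (l * m)"
        by (simp only: power_mult_distrib power_add power_mult[symmetric] mult.assoc mult.commute[of m l])
      also have "(m - l) * Suc m + l = (Suc m - l) * m"
        using le_Suc_ex[OF step.hyps(1)] by (auto simp: algebra_simps)
      also have "a 0 ^ ((Suc m - l) * m) * a (Suc m) ^ (l * m) = (a 0 ^ (Suc m - l) * a (Suc m) ^ l) ^ m"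
        by (simp only: power_mult_distrib power_mult[symmetric])
      finally show ?thesis
        using False nonneg
        by (subst (asm) power_mono_iff) (auto intro!: mult_nonneg_nonneg zero_le_power simp del: power_Suc)
    qed
  qed simp
qed

text \<open>Integration by parts gives \<open>\<integral>(u\<^sup>(\<^sup>j\<^sup>+\<^sup>1\<^sup>))\<^sup>2 = - \<integral>u\<^sup>(\<^sup>j\<^sup>+\<^sup>2\<^sup>) u\<^sup>(\<^sup>j\<^sup>)\<close>, and the powers of \<open>L\<close> match.\<close>
lemma scaled_derivative_energies_log_convex:
  fixes u :: "real \<Rightarrow> real"
  assumes "smooth u" and per: "\<And>t. u (t + L) = u t" and L: "L > 0"
  defines "a \<equiv> \<lambda>j. L ^ (2 * j + 1) * integral {0..L} (\<lambda>t. (nth_vderiv j u t)\<^sup>2)"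
  shows "0 \<le> a j" "(a (Suc j))\<^sup>2 \<le> a j * a (Suc (Suc j))"
proof -
  define N where "N = (\<lambda>j. integral {0..L} (\<lambda>t. (nth_vderiv j u t)\<^sup>2))"
  note c = smooth_continuous_on[OF assms(1), of "{0..L}"]
  have N: "0 \<le> N j" for j
    unfolding N_def by (intro integral_nonneg integrable_continuous_interval continuous_intros c) simp
  then show "0 \<le> a j" using L by (simp add: a_def N_def)
  have d: "(nth_vderiv k u has_real_derivative nth_vderiv (Suc k) u t) (at t)" for k t
    using smooth_has_vderiv[OF assms(1)] by (simp add: has_real_derivative_iff_has_vector_derivative)
  have p: "nth_vderiv k u L = nth_vderiv k u 0" for k
    using nth_vderiv_periodic[OF assms(1) per, of k 0] by simp
  have "N (Suc j) = - integral {0..L} (\<lambda>t. nth_vderiv (Suc (Suc j)) u t * nth_vderiv j u t)"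
    unfolding N_def power2_eq_square by (rule integral_by_parts_periodic[OF L d d c c p p])
  then have "(N (Suc j))\<^sup>2 \<le> N (Suc (Suc j)) * N j"
    unfolding N_def using integral_Cauchy_Schwarz[OF c c, of "Suc (Suc j)" j] by simp
  then have "(L ^ (2 * Suc j + 1))\<^sup>2 * (N (Suc j))\<^sup>2 \<le> (L ^ (2 * Suc j + 1))\<^sup>2 * (N (Suc (Suc j)) * N j)"
    by (intro mult_left_mono) auto
  moreover have "(L ^ (2 * Suc j + 1))\<^sup>2 = L ^ (2 * j + 1) * L ^ (2 * Suc (Suc j) + 1)"
    unfolding power_add[symmetric] power_mult[symmetric] by (rule arg_cong[of _ _ "power L"]) simp
  moreover have "a = (\<lambda>j. L ^ (2 * j + 1) * N j)" by (simp add: a_def N_def)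
  ultimately show "(a (Suc j))\<^sup>2 \<le> a j * a (Suc (Suc j))"
    by (simp only: power_mult_distrib mult_ac)
qed

section \<open>Interpolation from the first-order estimate\<close>

lemma powr_quotient_power:
  fixes b :: real
  assumes "0 < b"
  shows "(b powr (real k / (real m + 1))) ^ Suc m = b ^ k"
proof -
  have "real k / (real m + 1) * real (Suc m) = real k" by (simp add: field_simps)
  then show ?thesis
    using assms by (simp add: powr_realpow[symmetric] powr_powr del: power_Suc)
qed

text \<open>Two alternatives arise according to which summand of \<open>sqrt (a 1) + a 1\<close> dominates. With
  \<open>a 1 ^ m \<le> a 0 ^ (m - 1) * a m\<close> each of them becomes self-improving: it can be solved for \<open>a 0\<close>,
  yielding \<open>a 0 \<lesssim> J powr (m / 2) * a m\<close> in the linear case and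
  \<open>a 0 ^ (m + 1) \<lesssim> J ^ m * a m\<close> in the square-root case. Interpolating \<open>a l\<close> between \<open>a 0\<close> and \<open>a m\<close>
  turns them into the first and the second summand of the claim.\<close>
lemma interpolation_from_first_order:
  fixes a :: "nat \<Rightarrow> real"
  assumes nonneg: "\<And>j. 0 \<le> a j" and logconv: "\<And>j. (a (Suc j))\<^sup>2 \<le> a j * a (Suc (Suc j))"
    and J: "0 \<le> J" and K: "1 \<le> K" and first: "a 0 \<le> K / 2 * sqrt J * (sqrt (a 1) + a 1)"
    and "l < m"
  shows "a l \<le> K ^ (2 * (m - l)) * (J powr ((real m - real l) / 2) * a m
      + J powr ((real m - real l) / (real m + 1)) * a m powr ((real l + 1) / (real m + 1)))"
    (is "_ \<le> ?C * (?A + ?B)")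
proof (cases "a 0 = 0")
  case True
  have "a l ^ m \<le> 0"
    using log_convex_sequence_interpolation[of a l m] nonneg logconv \<open>l < m\<close> True
    by (simp add: power_0_left)
  then have "a l = 0" using nonneg[of l] by (auto simp: power_le_zero_eq)
  then show ?thesis using K nonneg[of m] by simp
next
  case False
  define X Y Z where "X = a 0" and "Y = a m" and "Z = a l"
  have m: "m > 0" using \<open>l < m\<close> by simp
  have X: "X > 0" using False nonneg[of 0] by (simp add: X_def)
  have XK: "X \<le> K / 2 * sqrt J * (sqrt (a 1) + a 1)" using first by (simp add: X_def)
  have J0: "J > 0" using XK X J by (cases "J = 0") auto
  have I1: "a 1 > 0" using XK X nonneg[of 1] by (cases "a 1 = 0") auto
  have one: "a 1 ^ m \<le> X ^ (m - 1) * Y"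
    using log_convex_sequence_interpolation[of a 1 m] nonneg logconv m by (simp add: X_def Y_def)
  have Zm: "Z ^ m \<le> X ^ (m - l) * Y ^ l"
    using log_convex_sequence_interpolation[of a l m] nonneg logconv \<open>l < m\<close>
    by (simp add: X_def Y_def Z_def)
  have Y: "Y > 0"
  proof -
    have "0 < a 1 ^ m" using I1 by simp
    then have "0 < X ^ (m - 1) * Y" using one by linarith
    then show ?thesis using X by (simp add: zero_less_mult_iff)
  qed
  have Z: "Z \<ge> 0" using nonneg by (simp add: Z_def)
  have Xm: "X ^ m = X ^ (m - 1) * X" using m by (simp add: power_eq_if)
  have A0: "?A > 0" and B0: "?B > 0" using J0 Y by (simp_all add: Y_def)
  have C: "K ^ (m - l) \<le> ?C" "1 \<le> ?C" using K by (auto intro!: power_increasing)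
  have "X \<le> K * sqrt J * a 1 \<or> X \<le> K * sqrt J * sqrt (a 1)"
    using XK by (simp add: algebra_simps) linarith
  then show ?thesis
  proof
    assume "X \<le> K * sqrt J * a 1"
    then have "X ^ m \<le> (K * sqrt J * a 1) ^ m" using X by (intro power_mono) auto
    also have "\<dots> \<le> (K * sqrt J) ^ m * (X ^ (m - 1) * Y)"
      unfolding power_mult_distrib[of _ "a 1"] using one K J by (intro mult_left_mono) auto
    finally have "X ^ (m - 1) * X \<le> X ^ (m - 1) * ((K * sqrt J) ^ m * Y)"
      unfolding Xm by (simp only: mult_ac)
    then have XY: "X \<le> (K * sqrt J) ^ m * Y" using X by simp
    have "Z ^ m \<le> ((K * sqrt J) ^ m * Y) ^ (m - l) * Y ^ l"
      using Zm XY X Y by (elim order_trans) (intro mult_right_mono power_mono; simp)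
    also have "\<dots> = ((K * sqrt J) ^ (m - l) * Y) ^ m"
      using \<open>l < m\<close>
      by (simp add: power_mult_distrib mult.assoc flip: power_mult power_add)
        (simp add: mult.commute)
    finally have "Z \<le> (K * sqrt J) ^ (m - l) * Y"
      using m Z K J Y power_mono_iff[of Z "(K * sqrt J) ^ (m - l) * Y" m] by simp
    also have "\<dots> = K ^ (m - l) * ?A"
      using J0 \<open>l < m\<close>
      by (simp add: power_mult_distrib Y_def powr_half_sqrt[symmetric] powr_realpow[symmetric] powr_powr of_nat_diff)
    also have "\<dots> \<le> ?C * ?A" using C(1) A0 by (intro mult_right_mono) auto
    also have "\<dots> \<le> ?C * (?A + ?B)" using C(2) A0 B0 by (intro mult_left_mono) auto
    finally show ?thesis by (simp add: Z_def)
  next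
    assume "X \<le> K * sqrt J * sqrt (a 1)"
    then have "X\<^sup>2 \<le> (K * sqrt J * sqrt (a 1))\<^sup>2" using X by (intro power_mono) auto
    also have "\<dots> = K\<^sup>2 * J * a 1" using J I1 by (simp add: power_mult_distrib)
    finally have "(X\<^sup>2) ^ m \<le> (K\<^sup>2 * J * a 1) ^ m" by (intro power_mono) auto
    also have "\<dots> \<le> (K\<^sup>2 * J) ^ m * (X ^ (m - 1) * Y)"
      unfolding power_mult_distrib[of _ "a 1"] using one K J by (intro mult_left_mono) auto
    finally have "X ^ (m - 1) * X ^ Suc m \<le> X ^ (m - 1) * ((K\<^sup>2 * J) ^ m * Y)"
      using m by (simp add: mult_ac mult_2_right flip: power_mult power_add power_Suc)
    then have XY: "X ^ Suc m \<le> (K\<^sup>2 * J) ^ m * Y" using X by (simp del: power_Suc)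
    have "(Z ^ Suc m) ^ m = (Z ^ m) ^ Suc m"
      by (simp only: power_mult[symmetric] mult.commute[of "Suc m" m])
    also have "\<dots> \<le> (X ^ (m - l) * Y ^ l) ^ Suc m"
      using Zm Z by (intro power_mono) auto
    also have "\<dots> = (X ^ Suc m) ^ (m - l) * Y ^ (l * Suc m)"
      by (simp only: power_mult_distrib power_mult[symmetric] mult.commute[of "m - l" "Suc m"])
    also have "\<dots> \<le> ((K\<^sup>2 * J) ^ m * Y) ^ (m - l) * Y ^ (l * Suc m)"
      using XY X Y by (intro mult_right_mono power_mono) auto
    also have "\<dots> = (K\<^sup>2 * J) ^ (m * (m - l)) * Y ^ ((m - l) + l * Suc m)"
      by (simp only: power_mult_distrib power_mult[symmetric] power_add mult.assoc)
    also have "(m - l) + l * Suc m = Suc l * m" using \<open>l < m\<close> by simp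
    also have "(K\<^sup>2 * J) ^ (m * (m - l)) * Y ^ (Suc l * m) = ((K\<^sup>2 * J) ^ (m - l) * Y ^ Suc l) ^ m"
      by (simp only: power_mult_distrib[of "_ ^ (m - l)"] power_mult[symmetric] mult.commute[of m "m - l"])
    finally have "Z ^ Suc m \<le> (K\<^sup>2 * J) ^ (m - l) * Y ^ Suc l"
      using m Z J Y by (subst (asm) power_mono_iff) auto
    also have "\<dots> = ?C * (J ^ (m - l) * Y ^ Suc l)"
      by (simp add: power_mult_distrib power_mult)
    \<comment> \<open>The constant is enlarged to a perfect power, so that both alternatives share it.\<close>
    also have "\<dots> \<le> ?C ^ Suc m * (J ^ (m - l) * Y ^ Suc l)"
      using C(2) J Y self_le_power[of ?C "Suc m"] by (intro mult_right_mono) auto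
    also have "J ^ (m - l) * Y ^ Suc l = ?B ^ Suc m"
      using powr_quotient_power[OF J0, of "m - l" m] powr_quotient_power[OF Y, of "Suc l" m] \<open>l < m\<close>
      by (simp add: power_mult_distrib Y_def of_nat_diff add.commute del: power_Suc)
    also have "?C ^ Suc m * ?B ^ Suc m = (?C * ?B) ^ Suc m" by (rule power_mult_distrib[symmetric])
    finally have "Z \<le> ?C * ?B"
      using Z B0 C(2) power_mono_iff[of Z "?C * ?B" "Suc m"] by (simp del: power_Suc)
    also have "\<dots> \<le> ?C * (?A + ?B)" using C(2) A0 B0 by (intro mult_left_mono) auto
    finally show ?thesis by (simp add: Z_def)
  qed
qed

section \<open>Closed plane curves\<close>

lemma smooth_curvature:
  assumes "smooth f"
  shows "smooth (curvature f)"
proof -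
  have s: "smooth (\<lambda>t. nth_vderiv n f t $ i)" for n i
    by (intro smooth_component smooth_nth_vderiv assms)
  have "curvature f = (\<lambda>t. nth_vderiv 1 f t $ 1 * nth_vderiv 2 f t $ 2
      - nth_vderiv 1 f t $ 2 * nth_vderiv 2 f t $ 1)"
    by (auto simp: curvature_def normal_vec_def inner_vec_def UNIV_2 mult.commute)
  then show ?thesis by (simp only:) (intro smooth_diff smooth_mult s)
qed

text \<open>Differentiating \<open>|f'|\<^sup>2 = 1\<close> shows that \<open>f''\<close> is orthogonal to \<open>f'\<close>, hence equal to its normal part.\<close>
lemma Frenet_equations:
  assumes "arclength_closed_curve L f"
  shows "(nth_vderiv 1 f t $ 1)\<^sup>2 + (nth_vderiv 1 f t $ 2)\<^sup>2 = 1"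
    and "nth_vderiv 2 f t $ 1 = - curvature f t * nth_vderiv 1 f t $ 2"
    and "nth_vderiv 2 f t $ 2 = curvature f t * nth_vderiv 1 f t $ 1"
proof -
  have f: "smooth f" using assms by (simp add: arclength_closed_curve_def)
  define X Y where "X = nth_vderiv 2 f t $ 1" and "Y = nth_vderiv 2 f t $ 2"
  define x' y' where "x' = (\<lambda>t. nth_vderiv 1 f t $ 1)" and "y' = (\<lambda>t. nth_vderiv 1 f t $ 2)"
  have unit: "(x' t)\<^sup>2 + (y' t)\<^sup>2 = 1" for t
  proof -
    have "norm (nth_vderiv 1 f t) = 1" using assms by (simp add: arclength_closed_curve_def)
    then show ?thesis
      by (simp add: x'_def y'_def norm_eq_1 inner_vec_def UNIV_2 power2_eq_square)
  qed
  then show "(nth_vderiv 1 f t $ 1)\<^sup>2 + (nth_vderiv 1 f t $ 2)\<^sup>2 = 1"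
    by (simp add: x'_def y'_def)
  have d: "((\<lambda>t. nth_vderiv 1 f t $ i) has_real_derivative nth_vderiv 2 f t $ i) (at t)" for i
    using bounded_linear.has_vector_derivative[OF bounded_linear_vec_nth smooth_has_vderiv[OF f, of 1 t]]
    by (simp add: has_real_derivative_iff_has_vector_derivative numeral_2_eq_2)
  have "((\<lambda>t. (x' t)\<^sup>2 + (y' t)\<^sup>2) has_real_derivative 2 * x' t * X + 2 * y' t * Y) (at t)"
    using d unfolding x'_def y'_def X_def Y_def by (auto intro!: derivative_eq_intros)
  then have "2 * x' t * X + 2 * y' t * Y = 0"
    unfolding unit using DERIV_const DERIV_unique by blast
  then have orth: "x' t * X + y' t * Y = 0" by simp
  have k: "curvature f t = x' t * Y - y' t * X"
    by (simp add: curvature_def normal_vec_def inner_vec_def UNIV_2 x'_def y'_def X_def Y_def mult.commute)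
  have "- curvature f t * y' t = X * ((x' t)\<^sup>2 + (y' t)\<^sup>2) - x' t * (x' t * X + y' t * Y)"
    "curvature f t * x' t = Y * ((x' t)\<^sup>2 + (y' t)\<^sup>2) - y' t * (x' t * X + y' t * Y)"
    unfolding k by algebra+
  then show "nth_vderiv 2 f t $ 1 = - curvature f t * nth_vderiv 1 f t $ 2"
    "nth_vderiv 2 f t $ 2 = curvature f t * nth_vderiv 1 f t $ 1"
    unfolding unit orth by (simp_all add: x'_def y'_def X_def Y_def)
qed

lemma curvature_dev_facts:
  assumes L: "L > 0" and f: "arclength_closed_curve L f"
  shows "smooth (curvature_dev L f)" "curvature_dev L f (t + L) = curvature_dev L f t"
    "integral {0..L} (curvature_dev L f) = 0"
proof -
  have s: "smooth (curvature f)" using f smooth_curvature by (simp add: arclength_closed_curve_def)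
  have eq: "curvature_dev L f = (\<lambda>t. curvature f t - 1 / L * integral {0..L} (curvature f))"
    by (auto simp: curvature_dev_def)
  show "smooth (curvature_dev L f)" unfolding eq by (intro smooth_diff s smooth_const)
  have "nth_vderiv n f (t + L) = nth_vderiv n f t" for n
    using f by (intro nth_vderiv_periodic) (auto simp: arclength_closed_curve_def)
  then show "curvature_dev L f (t + L) = curvature_dev L f t"
    by (simp add: curvature_dev_def curvature_def normal_vec_def)
  have "curvature f integrable_on {0..L}"
    using smooth_continuous_on[OF s, of "{0..L}" 0] by (simp add: integrable_continuous_interval)
  then show "integral {0..L} (curvature_dev L f) = 0"
    unfolding eq using L by (subst integral_diff) auto
qed

text \<open>Nothing in the statement changes under translations, since \<open>f'\<close> has mean zero. So the curve may be
  moved to have its centre of mass at the origin, where the estimate in the moving frame applies.\<close>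
lemma I_curv_0_le_gradient_estimate:
  assumes L: "L > 0" and f: "arclength_closed_curve L f" and rot: "rotation_number_one L f"
  shows "0 \<le> I_iso L f"
    and "I_curv 0 L f \<le> sqrt 2 * (1 + 2 * pi) * sqrt (I_iso L f) * (sqrt (I_curv 1 L f) + I_curv 1 L f)"
proof -
  have sf: "smooth f" and perf: "f (t + L) = f t" for t
    using f by (simp_all add: arclength_closed_curve_def)
  define w where "w = 2 * pi / L"
  define q where "q = curvature_dev L f"
  note q = curvature_dev_facts[OF L f, folded q_def]
  have curv: "curvature f t = w + q t" for t
    using rot by (simp add: q_def curvature_dev_def rotation_number_one_def w_def)
  define x' y' where "x' = (\<lambda>t. nth_vderiv 1 f t $ 1)" and "y' = (\<lambda>t. nth_vderiv 1 f t $ 2)"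
  define c where "c = (\<lambda>i. 1 / L * integral {0..L} (\<lambda>t. f t $ i))"
  define x y where "x = (\<lambda>t. f t $ 1 - c 1)" and "y = (\<lambda>t. f t $ 2 - c 2)"
  have d: "((\<lambda>t. nth_vderiv n f t $ i) has_real_derivative nth_vderiv (Suc n) f t $ i) (at t)" for i n t
    using bounded_linear.has_vector_derivative[OF bounded_linear_vec_nth smooth_has_vderiv[OF sf, of n t]]
    by (simp add: has_real_derivative_iff_has_vector_derivative)
  have cont: "continuous_on {0..L} (\<lambda>t. nth_vderiv n f t $ i)" for n i
    by (intro continuous_intros smooth_continuous_on sf)
  note cont0 = cont[of 0, simplified]
  have dx: "(x has_real_derivative x' t) (at t)" "(y has_real_derivative y' t) (at t)" for t
    using DERIV_diff[OF d[of 0] DERIV_const] unfolding x_def y_def x'_def y'_def by simp_all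
  have dx': "(x' has_real_derivative - (w + q t) * y' t) (at t)"
    "(y' has_real_derivative (w + q t) * x' t) (at t)" for t
    using d[of 1 _ t] Frenet_equations(2,3)[OF f, of t]
    unfolding x'_def y'_def curv by (metis Suc_1)+
  have dq: "(q has_real_derivative nth_vderiv 1 q t) (at t)" for t
    using smooth_has_vderiv[OF q(1), of 0 t] by (simp add: has_real_derivative_iff_has_vector_derivative)
  have per: "x (t + L) = x t" "y (t + L) = y t" "x' (t + L) = x' t" "y' (t + L) = y' t" for t
    using perf nth_vderiv_periodic[OF sf perf] by (simp_all add: x_def y_def x'_def y'_def)
  have mean: "integral {0..L} x = 0" "integral {0..L} y = 0"
    unfolding x_def y_def c_def using L
    by (subst integral_diff; (intro integrable_continuous_interval cont0)?; simp)+
  have unit: "(x' t)\<^sup>2 + (y' t)\<^sup>2 = 1" for t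
    using Frenet_equations(1)[OF f] by (simp add: x'_def y'_def)
  have I1: "I_curv 1 L f = L ^ 3 * integral {0..L} (\<lambda>t. (nth_vderiv 1 q t)\<^sup>2)"
    by (simp add: I_curv_def q_def)
  have I0: "I_curv 0 L f = L * integral {0..L} (\<lambda>t. (q t)\<^sup>2)"
    by (simp add: I_curv_def q_def)
  have i: "(\<lambda>t. f t $ 1 * y' t - f t $ 2 * x' t) integrable_on {0..L}"
    "x' integrable_on {0..L}" "y' integrable_on {0..L}"
    unfolding x'_def y'_def by (intro integrable_continuous_interval continuous_intros cont cont0)+
  have z: "(x' has_integral x L - x 0) {0..L}" "(y' has_integral y L - y 0) {0..L}"
    using dx L by (auto intro!: fundamental_theorem_of_calculus has_vector_derivative_at_within[of _ _ _ "{0..L}"]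
        simp: has_real_derivative_iff_has_vector_derivative)
  have z: "(x' has_integral 0) {0..L}" "(y' has_integral 0) {0..L}"
    using z per(1,2)[of 0] by simp_all
  have "((\<lambda>t. (f t $ 1 * y' t - f t $ 2 * x' t) - (c 1 * y' t - c 2 * x' t)) has_integral
      integral {0..L} (\<lambda>t. f t $ 1 * y' t - f t $ 2 * x' t) - (c 1 * 0 - c 2 * 0)) {0..L}"
    by (intro has_integral_diff has_integral_mult_right z integrable_integral i)
  moreover have "(\<lambda>t. (f t $ 1 * y' t - f t $ 2 * x' t) - (c 1 * y' t - c 2 * x' t))
      = (\<lambda>t. x t * y' t - y t * x' t)"
    by (auto simp: x_def y_def algebra_simps)
  ultimately have B: "integral {0..L} (\<lambda>t. x t * y' t - y t * x' t)
      = integral {0..L} (\<lambda>t. f t $ 1 * y' t - f t $ 2 * x' t)"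
    by (simp add: has_integral_iff)
  have "(\<lambda>t. f t \<bullet> normal_vec f t) = (\<lambda>t. - (f t $ 1 * y' t - f t $ 2 * x' t))"
    by (auto simp: normal_vec_def inner_vec_def UNIV_2 x'_def y'_def)
  then have "integral {0..L} (\<lambda>t. f t \<bullet> normal_vec f t)
      = - integral {0..L} (\<lambda>t. f t $ 1 * y' t - f t $ 2 * x' t)"
    by (simp only: integral_neg)
  then have "signed_area L f = 1 / 2 * integral {0..L} (\<lambda>t. x t * y' t - y t * x' t)"
    unfolding signed_area_def B by simp
  then have J: "I_iso L f = 1 - 2 * pi / L / L * integral {0..L} (\<lambda>t. x t * y' t - y t * x' t)"
    by (simp add: I_iso_def power2_eq_square)
  have r: "0 \<le> I_curv 1 L f"
    unfolding I1 using L
    by (intro mult_nonneg_nonneg integral_nonneg integrable_continuous_interval continuous_intros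
        smooth_continuous_on q(1)) auto
  note est = frame_estimate[OF L dx dx'[unfolded w_def] dq smooth_continuous_on[OF q(1)] unit per q(2) mean q(3),
      folded J I1 I0]
  show "0 \<le> I_iso L f" by (rule est(1))
  show "I_curv 0 L f \<le> sqrt 2 * (1 + 2 * pi) * sqrt (I_iso L f) * (sqrt (I_curv 1 L f) + I_curv 1 L f)"
    using est(2) r by simp
qed

theorem theorem3p1:
  fixes l m :: nat
  assumes "l \<le> m"
  shows "\<exists>C::real. C > 0 \<and>
    (\<forall>(L::real) (f :: real \<Rightarrow> real ^ 2).
       L > 0 \<longrightarrow> arclength_closed_curve L f \<longrightarrow> rotation_number_one L f \<longrightarrow>
       I_curv l L f \<le>
         C * (rpow (I_iso L f) ((real m - real l) / 2) * I_curv m L f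
            + rpow (I_iso L f) ((real m - real l) / (real m + 1))
              * rpow (I_curv m L f) ((real l + 1) / (real m + 1))))"
proof -
  define K :: real where "K = 2 * (sqrt 2 * (1 + 2 * pi))"
  have "1 * 1 \<le> sqrt 2 * (1 + 2 * pi)" by (intro mult_mono) auto
  then have K: "1 \<le> K" by (simp add: K_def)
  show ?thesis
  proof (intro exI[of _ "K ^ (2 * (m - l))"] conjI allI impI)
    show "0 < K ^ (2 * (m - l))" using K by simp
    fix L f assume L: "L > 0" and f: "arclength_closed_curve L f" and rot: "rotation_number_one L f"
    have I: "(\<lambda>j. I_curv j L f) = (\<lambda>j. L ^ (2 * j + 1) *
        integral {0..L} (\<lambda>t. (nth_vderiv j (curvature_dev L f) t)\<^sup>2))"
      by (simp add: I_curv_def)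
    note conv = scaled_derivative_energies_log_convex[OF curvature_dev_facts(1,2)[OF L f] L,
        folded fun_cong[OF I]]
    show "I_curv l L f \<le> K ^ (2 * (m - l)) * (rpow (I_iso L f) ((real m - real l) / 2) * I_curv m L f
            + rpow (I_iso L f) ((real m - real l) / (real m + 1))
              * rpow (I_curv m L f) ((real l + 1) / (real m + 1)))"
    \<comment> \<open>For \<open>l = m\<close> the exponents of the deficit vanish, and with the convention \<open>x\<^sup>0 = 1\<close> the claim is
      trivial even on circles.\<close>
    proof (cases "l = m")
      case True
      then show ?thesis using conv(1)[of m] by (simp add: rpow_def)
    next
      case False
      then have lm: "l < m" using assms by simp
      have "I_curv l L f \<le> K ^ (2 * (m - l)) * (I_iso L f powr ((real m - real l) / 2) * I_curv m L f
            + I_iso L f powr ((real m - real l) / (real m + 1))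
              * I_curv m L f powr ((real l + 1) / (real m + 1)))"
        using I_curv_0_le_gradient_estimate[OF L f rot] K
        by (intro interpolation_from_first_order[where a = "\<lambda>j. I_curv j L f"] conv lm)
          (simp_all add: K_def)
      then show ?thesis using lm by (simp add: rpow_def)
    qed
  qed
qed

end
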